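(* Consider an instance of the two-stage robust problem and its $k$-adaptability counterpart with second-stage dimension $n$, belonging to a problem class with second-stage cardinality bounds $\underline p,\bar p$ (with $\underline p(n)>0$) and with cost bounds $0<m_\infty\le M_\infty$, where $d\ge0$ and $d^\top x\ge0$ for all $x\in X$. Let $\tilde M(n):=\frac{M_\infty}{m_\infty}\frac{\bar p(n)}{\underline p(n)}$, let $a:\mathbb N\to\mathbb R_+$, and let $k=qn$ be an integer with $q\in(0,1]$. Then $$\mathrm{adapt}(k)\le(1+a(n))\,\mathrm{opt}(2RO)$$ for all $$q\in\left[\frac{\tilde M(n)}{\tilde M(n)+a(n)},\,1\right].$$
   Context: Notation: $\mathbb N=\{1,2,\dots\}$, $[k]=\{1,\dots,k\}$, $\mathbb R_+^n=\{y\in\mathbb R^n:y\ge0\}$, and $\|y\|_0$ is the number of non-zero entries of $y$. An instance consists of a nonempty first-stage set $X\subseteq\mathbb R^m$, nonempty second-stage sets $Y(x)\subseteq\{0,1\}^n$ for $x\in X$, a nonempty convex uncertainty set $U\subseteq\mathbb R_+^n$ and first-stage costs $d\in\mathbb R_+^m$; all minima and maxima written are understood to be attained. The two-stage robust problem is $$\min_{x\in X}\ \max_{\xi\in U}\ \min_{y\in Y(x)}\ d^\top x+\xi^\top y,$$ with optimal value $\mathrm{opt}(2RO)$. For $k\in\mathbb N$ the $k$-adaptability problem is $$\min_{x\in X,\ y^1,\dots,y^k\in Y(x)}\ \max_{\xi\in U}\ \min_{i=1,\dots,k}\ d^\top x+\xi^\top y^i,$$ with optimal value $\mathrm{adapt}(k)$.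 A problem class has second-stage cardinality bounds $\underline p,\bar p:\mathbb N\to\mathbb R_+$ if for every instance with $n$ second-stage variables $\underline p(n)\le\|y\|_0\le\bar p(n)$ for all $x\in X$ and $y\in Y(x)$. Cost bounds $0<m_\infty\le M_\infty$ means that $m_\infty\le\xi_j\le M_\infty$ for all $\xi\in U$ and $j\in[n]$. *)

theory Defs
  imports "HOL-Analysis.Analysis"
begin

record ('m, 'n) two_stage =
  first_stage :: "(real ^ 'm) set"
  second_stage :: "real ^ 'm \<Rightarrow> (real ^ 'n) set"
  uncertainty :: "(real ^ 'n) set"
  first_cost :: "real ^ 'm"

definition two_stage_instance :: "('m::finite, 'n::finite) two_stage \<Rightarrow> bool" where
  "two_stage_instance I \<longleftrightarrow>
     first_stage I \<noteq> {} \<and>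
     (\<forall>x\<in>first_stage I. second_stage I x \<noteq> {} \<and>
        second_stage I x \<subseteq> {y. \<forall>j. y $ j \<in> {0, 1}}) \<and>
     uncertainty I \<noteq> {} \<and> convex (uncertainty I) \<and>
     uncertainty I \<subseteq> {\<xi>. \<forall>j. 0 \<le> \<xi> $ j} \<and>
     (\<forall>j. 0 \<le> first_cost I $ j)"

definition attains_min :: "('a \<Rightarrow> real) \<Rightarrow> 'a set \<Rightarrow> bool" where
  "attains_min f S \<longleftrightarrow> (\<exists>x\<in>S. \<forall>z\<in>S. f x \<le> f z)"

definition attains_max :: "('a \<Rightarrow> real) \<Rightarrow> 'a set \<Rightarrow> bool" where
  "attains_max f S \<longleftrightarrow> (\<exists>x\<in>S. \<forall>z\<in>S. f z \<le> f x)"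

text \<open>
  The outer minima and the maxima below are written with the real-valued \<open>INF\<close> and \<open>SUP\<close>, which
  are the intended values only under the corresponding attainment predicates. The innermost minima
  range over finite nonempty sets: \<open>second_stage I x\<close> consists of 0-1 vectors, and \<open>k \<ge> 1\<close>.
\<close>

definition recourse_value :: "('m::finite, 'n::finite) two_stage \<Rightarrow> real ^ 'm \<Rightarrow> real ^ 'n \<Rightarrow> real" where
  "recourse_value I x \<xi> = (MIN y\<in>second_stage I x. first_cost I \<bullet> x + \<xi> \<bullet> y)"

definition worst_case :: "('m::finite, 'n::finite) two_stage \<Rightarrow> real ^ 'm \<Rightarrow> real" where
  "worst_case I x = (SUP \<xi>\<in>uncertainty I. recourse_value I x \<xi>)"

definition opt_2RO :: "('m::finite, 'n::finite) two_stage \<Rightarrow> real" where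
  "opt_2RO I = (INF x\<in>first_stage I. worst_case I x)"

definition attained_2RO :: "('m::finite, 'n::finite) two_stage \<Rightarrow> bool" where
  "attained_2RO I \<longleftrightarrow>
     (\<forall>x\<in>first_stage I. attains_max (recourse_value I x) (uncertainty I)) \<and>
     attains_min (worst_case I) (first_stage I)"

definition adapt_feasible ::
  "('m::finite, 'n::finite) two_stage \<Rightarrow> nat \<Rightarrow> ((real ^ 'm) \<times> (nat \<Rightarrow> real ^ 'n)) set" where
  "adapt_feasible I k = (SIGMA x:first_stage I. {1..k} \<rightarrow>\<^sub>E second_stage I x)"

definition adapt_recourse_value ::
  "('m::finite, 'n::finite) two_stage \<Rightarrow> nat \<Rightarrow> (real ^ 'm) \<times> (nat \<Rightarrow> real ^ 'n) \<Rightarrow> real ^ 'n \<Rightarrow> real" where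
  "adapt_recourse_value I k = (\<lambda>(x, y) \<xi>. MIN i\<in>{1..k}. first_cost I \<bullet> x + \<xi> \<bullet> y i)"

definition adapt_worst_case ::
  "('m::finite, 'n::finite) two_stage \<Rightarrow> nat \<Rightarrow> (real ^ 'm) \<times> (nat \<Rightarrow> real ^ 'n) \<Rightarrow> real" where
  "adapt_worst_case I k s = (SUP \<xi>\<in>uncertainty I. adapt_recourse_value I k s \<xi>)"

definition adapt :: "('m::finite, 'n::finite) two_stage \<Rightarrow> nat \<Rightarrow> real" where
  "adapt I k = (INF s\<in>adapt_feasible I k. adapt_worst_case I k s)"

definition attained_adapt :: "('m::finite, 'n::finite) two_stage \<Rightarrow> nat \<Rightarrow> bool" where
  "attained_adapt I k \<longleftrightarrow>
     (\<forall>s\<in>adapt_feasible I k. attains_max (adapt_recourse_value I k s) (uncertainty I)) \<and>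
     attains_min (adapt_worst_case I k) (adapt_feasible I k)"

definition norm0 :: "real ^ 'n::finite \<Rightarrow> nat" where
  "norm0 y = card {j. y $ j \<noteq> 0}"

text \<open>
  Dimensions are types here, so a set \<open>C\<close> of instances is the part of a problem class with
  \<open>CARD('m)\<close> first-stage and \<open>CARD('n)\<close> second-stage variables. The bounds are functions on the
  positive integers; their values at 0 are left unconstrained.
\<close>

definition cardinality_bounds ::
  "('m::finite, 'n::finite) two_stage set \<Rightarrow> (nat \<Rightarrow> real) \<Rightarrow> (nat \<Rightarrow> real) \<Rightarrow> bool" where
  "cardinality_bounds C p_lo p_up \<longleftrightarrow>
     (\<forall>n\<ge>1. 0 \<le> p_lo n \<and> 0 \<le> p_up n) \<and>
     (\<forall>I\<in>C. \<forall>x\<in>first_stage I. \<forall>y\<in>second_stage I x.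
        p_lo CARD('n) \<le> real (norm0 y) \<and> real (norm0 y) \<le> p_up CARD('n))"

definition cost_bounds :: "('m::finite, 'n::finite) two_stage \<Rightarrow> real \<Rightarrow> real \<Rightarrow> bool" where
  "cost_bounds I m_inf M_inf \<longleftrightarrow>
     0 < m_inf \<and> m_inf \<le> M_inf \<and>
     (\<forall>\<xi>\<in>uncertainty I. \<forall>j. m_inf \<le> \<xi> $ j \<and> \<xi> $ j \<le> M_inf)"

definition M_tilde :: "real \<Rightarrow> real \<Rightarrow> (nat \<Rightarrow> real) \<Rightarrow> (nat \<Rightarrow> real) \<Rightarrow> nat \<Rightarrow> real" where
  "M_tilde m_inf M_inf p_lo p_up n = M_inf / m_inf * (p_up n / p_lo n)"

end

theory Submission
  imports Defs
begin

text \<open>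
  Fix an optimal first stage \<open>x\<close>. By minimax, a single point of the convex hull of the recourse set
  is at least as good as the optimal value against every scenario. As scenarios are
  nonnegative, this point may be lowered along the all-ones vector to the boundary of the hull, where
  Caratheodory's theorem needs only \<open>n\<close> instead of \<open>n + 1\<close> recourse vectors. The \<open>k = q n\<close>
  heaviest of them carry weight at least \<open>q\<close>, so in each scenario the best of these \<open>k\<close>
  costs at most \<open>1 / q\<close> times the optimum. Finally \<open>1 / q \<le> 1 + a\<close>, because \<open>M_tilde \<ge> 1\<close>.
\<close>

section \<open>Minimax via separation and polar cones\<close>

text \<open>If no such point exists, a hyperplane separates the compact
  \<open>K \<times> {1}\<close> from the polar cone of the lifted scenarios. By bipolarity its
  normal is a limit of nonnegative multiples of lifted scenarios, and a close enough multiple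
  exhibits one scenario in which every point of \<open>K\<close> costs more than
  \<open>v\<close>.\<close>

lemma minimax_point:
  fixes U K :: "'a::euclidean_space set"
  assumes "convex U" "U \<noteq> {}" "convex K" "compact K" "K \<noteq> {}"
    and le: "\<And>\<xi>. \<xi> \<in> U \<Longrightarrow> \<exists>y\<in>K. \<xi> \<bullet> y \<le> v"
  shows "\<exists>y\<in>K. \<forall>\<xi>\<in>U. \<xi> \<bullet> y \<le> v"
proof (rule ccontr)
  assume no: "\<not> ?thesis"
  \<comment> \<open>The extra coordinate makes the bound homogeneous:
    \<open>\<xi> \<bullet> y \<le> v\<close> becomes
    \<open>(\<xi>, - v) \<bullet> (y, 1) \<le> 0\<close>, so a common solution in \<open>K\<close>
    is a point of \<open>D\<close> at height 1.\<close>
  define G where "G = (\<lambda>\<xi>. (\<xi>, - v)) ` U"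
  define D where "D = {w :: 'a \<times> real. \<forall>g\<in>G. g \<bullet> w \<le> 0}"
  have D_eq: "D = (\<Inter>g\<in>G. {w. g \<bullet> w \<le> 0})"
    by (auto simp: D_def)
  have "convex D"
    unfolding D_eq by (intro convex_INT convex_halfspace_le)
  moreover have "closed D"
    unfolding D_eq by (intro closed_INT ballI closed_halfspace_le)
  moreover have "convex (K \<times> {1::real})" "compact (K \<times> {1::real})" "K \<times> {1::real} \<noteq> {}"
    using assms by (auto intro: convex_Times compact_Times)
  moreover have "D \<inter> K \<times> {1} = {}"
    using no by (fastforce simp: D_def G_def)
  ultimately obtain g b where gb: "\<forall>w\<in>D. g \<bullet> w < b" "\<forall>w\<in>K \<times> {1}. g \<bullet> w > b"
    using separating_hyperplane_closed_compact by metis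
  have "0 \<in> D"
    by (simp add: D_def)
  with gb have "b > 0"
    by fastforce
  let ?C = "closure (convex_cone hull G)"
  \<comment> \<open>bipolar theorem: \<open>g\<close> is nonpositive on the polar cone \<open>D\<close> of \<open>G\<close>\<close>
  have "g \<in> ?C"
  proof (rule ccontr)
    assume "g \<notin> ?C"
    then obtain h c where hc: "h \<bullet> g < c" "\<forall>x\<in>?C. h \<bullet> x > c"
      using separating_hyperplane_closed_point[of ?C g]
      by (auto simp: convex_convex_cone_hull)
    have "0 \<in> ?C"
      using closure_subset convex_cone_hull_contains_0 by blast
    with hc have "c < 0"
      by fastforce
    have "h \<bullet> x \<ge> 0" if "x \<in> G" for x
    proof (rule ccontr)
      assume neg: "\<not> h \<bullet> x \<ge> 0"
      \<comment> \<open>At this multiple of \<open>x\<close>, \<open>h\<close> takes exactly the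
        value \<open>c\<close>, against strict separation from the cone.\<close>
      let ?t = "c / (h \<bullet> x)"
      have "?t \<ge> 0"
        using neg \<open>c < 0\<close> by (simp add: divide_nonpos_neg)
      moreover have "x \<in> convex_cone hull G"
        using that by (rule hull_inc)
      ultimately have "?t *\<^sub>R x \<in> ?C"
        using convex_cone_hull_mul closure_subset by blast
      with hc(2) have "h \<bullet> (?t *\<^sub>R x) > c"
        by blast
      then show False
        using neg by simp
    qed
    then have "t *\<^sub>R (- h) \<in> D" if "t \<ge> 0" for t
      using that by (auto simp: D_def inner_commute)
    moreover have "g \<bullet> h < 0"
      using hc \<open>c < 0\<close> by (simp add: inner_commute)
    \<comment> \<open>This multiple of \<open>- h\<close> lies in \<open>D\<close>, yet
      \<open>g\<close> takes the value \<open>b\<close> there, which is excluded on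
      \<open>D\<close>.\<close>
    then have "b / - (g \<bullet> h) \<ge> 0"
      using \<open>b > 0\<close> by (intro divide_nonneg_nonneg) auto
    ultimately have "g \<bullet> ((b / - (g \<bullet> h)) *\<^sub>R (- h)) < b"
      using gb(1) by blast
    then show False
      using \<open>g \<bullet> h < 0\<close> by simp
  qed
  have "bounded (K \<times> {1::real})"
    using \<open>compact K\<close> by (intro bounded_Times compact_imp_bounded) auto
  then obtain B where B: "B > 0" "\<And>w. w \<in> K \<times> {1::real} \<Longrightarrow> norm w \<le> B"
    unfolding bounded_pos by blast
  \<comment> \<open>\<open>U\<close> need not be closed, so \<open>g\<close> may lie outside the
    cone itself. The tolerance \<open>b / B\<close> changes inner products on
    \<open>K \<times> {1}\<close> by at most \<open>b\<close>, which keeps them positive.\<close>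
  obtain d where d: "d \<in> convex_cone hull G" "dist d g < b / B"
    using \<open>g \<in> ?C\<close> \<open>b > 0\<close> B(1) unfolding closure_approachable by (meson divide_pos_pos)
  have pos: "d \<bullet> w > 0" if w: "w \<in> K \<times> {1}" for w
  proof -
    have "(g - d) \<bullet> w \<le> norm (g - d) * norm w"
      by (rule norm_cauchy_schwarz)
    also have "\<dots> \<le> b / B * B"
      using d(2) B w \<open>b > 0\<close> by (intro mult_mono) (auto simp: dist_norm norm_minus_commute)
    also have "\<dots> = b"
      using B by simp
    finally show ?thesis
      using gb(2) w by (fastforce simp: inner_diff_left)
  qed
  \<comment> \<open>Convexity of \<open>U\<close> makes each element of the cone a multiple of a
    single lifted scenario.\<close>
  have "convex hull G = G"
  proof -
    have "G = U \<times> {- v}"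
      by (auto simp: G_def)
    then show ?thesis
      using \<open>convex U\<close> by (simp add: convex_Times convex_hull_eq)
  qed
  then obtain c \<xi> where c: "c \<ge> 0" "\<xi> \<in> U" "d = c *\<^sub>R (\<xi>, - v)"
    using d(1) \<open>U \<noteq> {}\<close> by (auto simp: convex_cone_hull_convex_hull_nonempty G_def)
  obtain y where y: "y \<in> K" "\<xi> \<bullet> y \<le> v"
    using le c(2) by blast
  have "0 < d \<bullet> (y, 1)"
    using pos y(1) by simp
  also have "\<dots> = c * (\<xi> \<bullet> y - v)"
    by (simp add: c(3) algebra_simps)
  also have "\<dots> \<le> 0"
    using c(1) y(2) by (simp add: mult_nonneg_nonpos)
  finally show False
    by simp
qed

section \<open>Caratheodory's theorem at the boundary of the hull\<close>

text \<open>Caratheodory gives at most \<open>DIM('a) + 1\<close> points. If all of these are used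
  and they are affinely dependent, their affine dimension is smaller and fewer points suffice. If
  they are independent, they span a full-dimensional simplex, whose interior consists of the points
  with positive weights only, so some weight of \<open>z\<close> vanishes.\<close>

lemma caratheodory_not_interior:
  fixes Y :: "'a::euclidean_space set"
  assumes "z \<in> convex hull Y" "z \<notin> interior (convex hull Y)"
  shows "\<exists>S\<subseteq>Y. finite S \<and> card S \<le> DIM('a) \<and> z \<in> convex hull S"
proof -
  obtain S where S: "finite S" "S \<subseteq> Y" "card S \<le> DIM('a) + 1" "z \<in> convex hull S"
    using assms(1) caratheodory[of Y] by blast
  show ?thesis
  proof (cases "card S \<le> DIM('a)")
    case True
    with S show ?thesis
      by blast
  next
    case card: False
    show ?thesis
    proof (cases "affine_dependent S")
      case True
      then have "aff_dim S \<noteq> int (card S) - 1"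
        using S(1) affine_independent_iff_card by blast
      then have "aff_dim S + 1 \<le> DIM('a)"
        using aff_dim_le_card[OF S(1)] S(3) by linarith
      moreover obtain T where "finite T" "T \<subseteq> S" "card T \<le> aff_dim S + 1" "z \<in> convex hull T"
        using S(4) caratheodory_aff_dim[of S] by blast
      ultimately show ?thesis
        using S(2) by (intro exI[of _ T]) auto
    next
      case False
      obtain u where u: "\<forall>x\<in>S. 0 \<le> u x" "sum u S = 1" "(\<Sum>x\<in>S. u x *\<^sub>R x) = z"
        using S(4) convex_hull_finite[OF S(1)] by auto
      have "z \<notin> interior (convex hull S)"
        using assms(2) S(2) by (meson hull_mono interior_mono subsetD)
      then have "\<not> (\<forall>x\<in>S. 0 < u x)"
        using u(2,3) card by (auto simp: interior_convex_hull_explicit_minimal[OF False])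
      then obtain w where w: "w \<in> S" "u w = 0"
        using u(1) by (meson antisym not_less)
      let ?T = "S - {w}"
      have "sum u ?T = 1" "(\<Sum>x\<in>?T. u x *\<^sub>R x) = z"
        using u w S(1) by (simp_all add: sum_diff1)
      then have "z \<in> convex hull ?T"
        using u(1) S(1) convex_hull_finite[of ?T] by auto
      then show ?thesis
        using S w(1) by (intro exI[of _ ?T]) auto
    qed
  qed
qed

text \<open>A ray from an interior point leaves the compact hull through its frontier, where one
  point fewer suffices; otherwise \<open>t = 0\<close> already works.\<close>

lemma caratheodory_along_ray:
  fixes Y :: "'a::euclidean_space set"
  assumes "finite Y" "y \<in> convex hull Y" "e \<noteq> 0"
  shows "\<exists>S t. S \<subseteq> Y \<and> finite S \<and> card S \<le> DIM('a) \<and> 0 \<le> t \<and> y + t *\<^sub>R e \<in> convex hull S"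
proof (cases "y \<in> interior (convex hull Y)")
  case False
  then show ?thesis
    using caratheodory_not_interior[OF assms(2)] by (metis add.right_neutral order_refl scaleR_zero_left)
next
  case True
  have compact: "compact (convex hull Y)"
    using assms(1) by (rule finite_imp_compact_convex_hull)
  obtain t where t: "0 < t" "y + t *\<^sub>R e \<in> frontier (convex hull Y)"
    using ray_to_frontier[OF compact_imp_bounded[OF compact] True assms(3)] by blast
  then have "y + t *\<^sub>R e \<in> convex hull Y" "y + t *\<^sub>R e \<notin> interior (convex hull Y)"
    using compact_imp_closed[OF compact] by (auto simp: frontier_def)
  from caratheodory_not_interior[OF this] t(1) show ?thesis
    by (meson less_imp_le)
qed

section \<open>Selecting the points of largest weight\<close>

text \<open>Removing a lightest element never lowers the average weight; repeat until
  \<open>k\<close> elements remain. The comparison of averages is stated without division, so that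
  empty sets are covered.\<close>

lemma heaviest_subset:
  fixes u :: "'a \<Rightarrow> real"
  assumes "finite T" "k \<le> card T"
  shows "\<exists>S\<subseteq>T. card S = k \<and> real k * sum u T \<le> real (card T) * sum u S"
  using assms
proof (induction "card T" arbitrary: T)
  case 0
  then show ?case
    by (intro exI[of _ T]) auto
next
  case (Suc c)
  show ?case
  proof (cases "k = Suc c")
    case True
    then show ?thesis
      using Suc.hyps(2) by (intro exI[of _ T]) auto
  next
    case False
    have "T \<noteq> {}"
      using Suc.hyps(2) by auto
    then obtain w where w: "w \<in> T" "\<And>x. x \<in> T \<Longrightarrow> u w \<le> u x"
      using Suc.prems(1) by (metis arg_min_if_finite(1) arg_min_least)
    let ?T = "T - {w}"
    have card: "card ?T = c" "k \<le> c"
      using Suc.hyps(2) Suc.prems False w(1) by auto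
    then obtain S where S: "S \<subseteq> ?T" "card S = k" "k * sum u ?T \<le> c * sum u S"
      using Suc.hyps(1)[of ?T] Suc.prems(1) by auto
    have "k * sum u T \<le> Suc c * sum u S"
    \<comment> \<open>The main case multiplies by \<open>c\<close> and cancels it at the
      end.\<close>
    proof (cases "c = 0")
      case True
      then have "S = {}"
        using S(1) card(1) Suc.prems(1) by auto
      then show ?thesis
        using True card(2) by simp
    next
      case False
      have "c * u w \<le> sum u ?T"
        using sum_bounded_below[of ?T "u w" u] w(2) card(1) by simp
      moreover have "sum u T = u w + sum u ?T"
        using Suc.prems(1) w(1) by (simp add: sum.remove)
      ultimately have "c * sum u T \<le> Suc c * sum u ?T"
        by (simp add: algebra_simps)
      then have "k * (c * sum u T) \<le> k * (Suc c * sum u ?T)"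
        by (intro mult_left_mono) auto
      also have "\<dots> = Suc c * (k * sum u ?T)"
        by simp
      also have "\<dots> \<le> Suc c * (c * sum u S)"
        using S(3) by (intro mult_left_mono) auto
      finally have "c * (k * sum u T) \<le> c * (Suc c * sum u S)"
        by (simp add: mult.left_commute)
      then show ?thesis
        using False by (simp only: mult_le_cancel_left_pos of_nat_0_less_iff neq0_conv)
    qed
    then show ?thesis
      using S(1,2) Suc.hyps(2) by (intro exI[of _ S]) auto
  qed
qed

lemma finite_binary_vectors: "finite {y :: real ^ 'n::finite. \<forall>j. y $ j \<in> {0, 1}}"
proof -
  have "{y :: real ^ 'n. \<forall>j. y $ j \<in> {0, 1}} \<subseteq> range (\<lambda>A :: 'n set. \<chi> j. if j \<in> A then 1 else 0)"
  proof
    fix y :: "real ^ 'n"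
    assume "y \<in> {y. \<forall>j. y $ j \<in> {0, 1}}"
    then have "y = (\<chi> j. if j \<in> {j. y $ j = 1} then 1 else 0)"
      by (auto simp: vec_eq_iff)
    then show "y \<in> range (\<lambda>A :: 'n set. \<chi> j. if j \<in> A then 1 else 0)"
      by (rule range_eqI)
  qed
  then show ?thesis
    by (rule finite_subset) simp
qed

text \<open>In each scenario the cheapest point of \<open>S\<close>, multiplied by the weight of
  \<open>S\<close>, costs at most the whole convex combination, since costs and weights are
  nonnegative. That weight is at least \<open>k / n\<close> with \<open>n = CARD('n)\<close>, hence
  the factor \<open>n / k\<close>.\<close>

lemma few_points_near_opt:
  fixes U Y :: "(real ^ 'n::finite) set"
  assumes U: "convex U" "U \<noteq> {}" "\<And>\<xi> j. \<xi> \<in> U \<Longrightarrow> 0 \<le> \<xi> $ j"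
    and Y: "finite Y" "Y \<noteq> {}" "\<And>y j. y \<in> Y \<Longrightarrow> 0 \<le> y $ j"
    and opt: "\<And>\<xi>. \<xi> \<in> U \<Longrightarrow> \<exists>y\<in>Y. \<xi> \<bullet> y \<le> v"
    and k: "1 \<le> k" "k \<le> CARD('n)"
  shows "\<exists>S\<subseteq>Y. S \<noteq> {} \<and> card S \<le> k \<and> (\<forall>\<xi>\<in>U. \<exists>y\<in>S. real k * (\<xi> \<bullet> y) \<le> real CARD('n) * v)"
proof -
  have "\<exists>y\<in>convex hull Y. \<xi> \<bullet> y \<le> v" if "\<xi> \<in> U" for \<xi>
    using opt[OF that] hull_inc by (metis (full_types))
  moreover have "convex hull Y \<noteq> {}"
    using Y(2) by simp
  ultimately have "\<exists>y\<in>convex hull Y. \<forall>\<xi>\<in>U. \<xi> \<bullet> y \<le> v"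
    using U(1,2) convex_convex_hull finite_imp_compact_convex_hull[OF Y(1)] by (intro minimax_point)
  then obtain y where y: "y \<in> convex hull Y" "\<And>\<xi>. \<xi> \<in> U \<Longrightarrow> \<xi> \<bullet> y \<le> v"
    by blast
  \<comment> \<open>Scenarios are nonnegative, so moving along \<open>e\<close> cannot raise any
    cost: the bound \<open>v\<close> survives the move to the frontier.\<close>
  define e :: "real ^ 'n" where "e = (\<chi> j. - 1)"
  have "e \<noteq> 0"
    by (simp add: e_def vec_eq_iff)
  obtain T t where T: "T \<subseteq> Y" "finite T" "card T \<le> CARD('n)" "0 \<le> t"
    "y + t *\<^sub>R e \<in> convex hull T"
    using caratheodory_along_ray[OF Y(1) y(1) \<open>e \<noteq> 0\<close>] by auto
  then obtain u where u: "\<forall>x\<in>T. 0 \<le> u x" "sum u T = 1" "(\<Sum>x\<in>T. u x *\<^sub>R x) = y + t *\<^sub>R e"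
    using convex_hull_finite[OF T(2)] by auto
  have le: "(\<Sum>x\<in>T. u x * (\<xi> \<bullet> x)) \<le> v" if "\<xi> \<in> U" for \<xi>
  proof -
    have "\<xi> \<bullet> e \<le> 0"
      using U(3)[OF that] by (simp add: inner_vec_def e_def sum_nonneg sum_negf)
    then have "t * (\<xi> \<bullet> e) \<le> 0"
      using T(4) by (simp add: mult_nonneg_nonpos)
    moreover have "(\<Sum>x\<in>T. u x * (\<xi> \<bullet> x)) = \<xi> \<bullet> y + t * (\<xi> \<bullet> e)"
      using arg_cong[OF u(3), of "\<lambda>z. \<xi> \<bullet> z"] by (simp add: inner_sum_right inner_add_right)
    ultimately show ?thesis
      using y(2)[OF that] by linarith
  qed
  have "\<exists>S\<subseteq>T. card S \<le> k \<and> real k \<le> real CARD('n) * sum u S"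
  proof (cases "card T \<le> k")
    case True
    then show ?thesis
      using u(2) k(2) by (intro exI[of _ T]) auto
  next
    case False
    then obtain S where S: "S \<subseteq> T" "card S = k" "real k \<le> real (card T) * sum u S"
      using heaviest_subset[OF T(2), of k u] u(2) by auto
    have "sum u S \<ge> 0"
      using u(1) S(1) by (intro sum_nonneg) auto
    then have "real (card T) * sum u S \<le> real CARD('n) * sum u S"
      using T(3) by (intro mult_right_mono) auto
    with S have "S \<subseteq> T \<and> card S \<le> k \<and> real k \<le> real CARD('n) * sum u S"
      by linarith
    then show ?thesis
      by blast
  qed
  then obtain S where S: "S \<subseteq> T" "card S \<le> k" "real k \<le> real CARD('n) * sum u S"
    by blast
  have "S \<noteq> {}"
    using S(3) k(1) by auto
  have "\<exists>y\<in>S. real k * (\<xi> \<bullet> y) \<le> real CARD('n) * v" if \<xi>: "\<xi> \<in> U" for \<xi>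
  proof -
    have "finite S"
      using S(1) T(2) by (rule finite_subset)
    then obtain y where min: "y \<in> S" "\<And>x. x \<in> S \<Longrightarrow> \<xi> \<bullet> y \<le> \<xi> \<bullet> x"
      using \<open>S \<noteq> {}\<close> by (metis arg_min_if_finite(1) arg_min_least)
    have nonneg: "0 \<le> \<xi> \<bullet> x" if "x \<in> Y" for x
      unfolding inner_vec_def using U(3)[OF \<xi>] Y(3)[OF that] by (simp add: sum_nonneg)
    have "real k * (\<xi> \<bullet> y) \<le> real CARD('n) * sum u S * (\<xi> \<bullet> y)"
      using S(3) nonneg min(1) S(1) T(1) by (intro mult_right_mono) auto
    also have "\<dots> = real CARD('n) * (sum u S * (\<xi> \<bullet> y))"
      by simp
    also have "sum u S * (\<xi> \<bullet> y) \<le> (\<Sum>x\<in>S. u x * (\<xi> \<bullet> x))"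
      unfolding sum_distrib_right using u(1) S(1) min(2) by (intro sum_mono mult_left_mono) auto
    also have "\<dots> \<le> (\<Sum>x\<in>T. u x * (\<xi> \<bullet> x))"
      using u(1) S(1) T(1,2) nonneg by (intro sum_mono2) auto
    also have "\<dots> \<le> v"
      by (rule le[OF \<xi>])
    finally show ?thesis
      using min(1) by (auto simp: mult_left_mono)
  qed
  then show ?thesis
    using S(1,2) T(1) \<open>S \<noteq> {}\<close> by (intro exI[of _ S]) auto
qed

section \<open>From recourse vectors to the adaptability bound\<close>

theorem lemma19:
  fixes C :: "('m::finite, 'n::finite) two_stage set"
    and I :: "('m, 'n) two_stage"
    and p_lo p_up a :: "nat \<Rightarrow> real"
    and m_inf M_inf q :: real
    and k :: nat
  assumes "\<forall>J\<in>C. two_stage_instance J" and "I \<in> C"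
    and "cardinality_bounds C p_lo p_up" and "p_lo CARD('n) > 0"
    and "cost_bounds I m_inf M_inf"
    and "\<forall>x\<in>first_stage I. first_cost I \<bullet> x \<ge> 0"
    and "\<forall>n\<ge>1. a n \<ge> 0"
    and "q \<in> {0<..1}" and "real k = q * real CARD('n)"
    and "attained_2RO I" and "attained_adapt I k"
    and "q \<in> {M_tilde m_inf M_inf p_lo p_up CARD('n) /
                (M_tilde m_inf M_inf p_lo p_up CARD('n) + a CARD('n))..1}"
  shows "adapt I k \<le> (1 + a CARD('n)) * opt_2RO I"
proof -
  let ?n = "CARD('n)" and ?M = "M_tilde m_inf M_inf p_lo p_up CARD('n)" and ?d = "first_cost I"
  let ?U = "uncertainty I"
  have inst: "two_stage_instance I"
    using assms(1,2) by blast
  obtain x where x: "x \<in> first_stage I" "\<And>z. z \<in> first_stage I \<Longrightarrow> worst_case I x \<le> worst_case I z"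
    using assms(10) unfolding attained_2RO_def attains_min_def by blast
  let ?Y = "second_stage I x"
  have U: "convex ?U" "?U \<noteq> {}" "\<And>\<xi> j. \<xi> \<in> ?U \<Longrightarrow> 0 \<le> \<xi> $ j"
    using inst unfolding two_stage_instance_def by auto
  have Y: "?Y \<noteq> {}" "?Y \<subseteq> {y. \<forall>j. y $ j \<in> {0, 1}}"
    using inst x(1) unfolding two_stage_instance_def by auto
  have finite_Y: "finite ?Y"
    using Y(2) finite_binary_vectors by (rule finite_subset)
  have Y_nonneg: "0 \<le> y $ j" if "y \<in> ?Y" for y j
  proof -
    have "y $ j \<in> {0, 1}"
      using Y(2) that by blast
    then show ?thesis
      by auto
  qed
  have dx: "?d \<bullet> x \<ge> 0"
    using assms(6) x(1) by blast
  have opt: "opt_2RO I = worst_case I x"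
    unfolding opt_2RO_def using x by (intro cInf_eq_minimum) auto
  \<comment> \<open>The budget left for the second stage once the optimal first stage is
    paid.\<close>
  define v where "v = opt_2RO I - ?d \<bullet> x"
  have reach: "\<exists>y\<in>?Y. \<xi> \<bullet> y \<le> v" if \<xi>: "\<xi> \<in> ?U" for \<xi>
  proof -
    have "bdd_above (recourse_value I x ` ?U)"
      using assms(10) x(1) unfolding attained_2RO_def attains_max_def bdd_above_def by blast
    then have "recourse_value I x \<xi> \<le> opt_2RO I"
      unfolding opt worst_case_def using \<xi> by (rule cSUP_upper[rotated])
    moreover have "recourse_value I x \<xi> \<in> (\<lambda>y. ?d \<bullet> x + \<xi> \<bullet> y) ` ?Y"
      unfolding recourse_value_def using finite_Y Y(1) by (intro Min_in) auto
    ultimately show ?thesis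
      by (force simp: v_def)
  qed
  have "real k > 0" "real k \<le> real ?n"
    using assms(8,9) by (auto simp: mult_left_le_one_le)
  then have k: "1 \<le> k" "k \<le> ?n"
    by simp_all
  obtain S where S: "S \<subseteq> ?Y" "S \<noteq> {}" "card S \<le> k"
    "\<And>\<xi>. \<xi> \<in> ?U \<Longrightarrow> \<exists>y\<in>S. real k * (\<xi> \<bullet> y) \<le> real ?n * v"
    using few_points_near_opt[OF U finite_Y Y(1) Y_nonneg reach k] by blast

  \<comment> \<open>A single affordable recourse vector shows both that \<open>v\<close> is
    nonnegative and that the cardinality bounds are ordered.\<close>
  obtain \<xi>0 y0 where y0: "\<xi>0 \<in> ?U" "y0 \<in> ?Y" "\<xi>0 \<bullet> y0 \<le> v"
    using U(2) reach by blast
  have "0 \<le> \<xi>0 \<bullet> y0"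
    unfolding inner_vec_def using U(3)[OF y0(1)] Y_nonneg[OF y0(2)] by (simp add: sum_nonneg)
  then have "v \<ge> 0"
    using y0(3) by linarith
  have "p_lo ?n \<le> p_up ?n"
    using assms(2,3) x(1) y0(2) unfolding cardinality_bounds_def by fastforce
  then have "1 \<le> p_up ?n / p_lo ?n" "1 \<le> M_inf / m_inf"
    using assms(4,5) by (auto simp: cost_bounds_def)
  then have "1 * 1 \<le> ?M"
    unfolding M_tilde_def by (intro mult_mono) auto
  then have M: "1 \<le> ?M"
    by simp
  have a: "a ?n \<ge> 0"
    using assms(7) by (simp add: Suc_leI)
  have "?M \<le> q * (?M + a ?n)"
    using assms(12) M a by (simp add: divide_le_eq)
  \<comment> \<open>As \<open>?M \<ge> 1\<close>, the term \<open>a\<close> may be enlarged to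
    \<open>?M * a\<close>; then \<open>?M\<close> cancels.\<close>
  then have "?M * 1 \<le> q * (?M + ?M * a ?n)"
    using mult_right_mono[OF M a] assms(8) by (smt (verit) greaterThanAtMost_iff mult_left_mono)
  then have "?M * 1 \<le> ?M * (q * (1 + a ?n))"
    by (simp add: algebra_simps)
  then have q: "1 \<le> q * (1 + a ?n)"
    using M by (simp only: mult_le_cancel_left_pos)

  have finite_S: "finite S"
    using S(1) finite_Y by (rule finite_subset)
  \<comment> \<open>A feasible solution lists exactly \<open>k\<close> vectors, so if
    \<open>S\<close> has fewer, the last one is repeated.\<close>
  obtain f where f: "f ` {1..k} = S"
  proof -
    obtain g where g: "bij_betw g {1..card S} S"
      using ex_bij_betw_nat_finite_1[OF finite_S] by blast
    have "card S \<ge> 1"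
      using finite_S S(2) by (simp add: Suc_leI card_gt_0_iff)
    then have "(\<lambda>i. g (min i (card S))) ` {1..k} = g ` {1..card S}"
      using S(3) by (force simp: image_iff)
    then show thesis
      using that g by (metis bij_betw_imp_surj_on)
  qed
  let ?s = "(x, restrict f {1..k})"
  have s: "?s \<in> adapt_feasible I k"
    using x(1) f S(1) by (auto simp: adapt_feasible_def)
  have "bdd_below (adapt_worst_case I k ` adapt_feasible I k)"
    using assms(11) unfolding attained_adapt_def attains_min_def bdd_below_def by blast
  then have "adapt I k \<le> adapt_worst_case I k ?s"
    unfolding adapt_def using s by (rule cINF_lower)
  also have "\<dots> \<le> (1 + a ?n) * opt_2RO I"
    unfolding adapt_worst_case_def
  proof (rule cSUP_least[OF U(2)])
    fix \<xi>
    assume "\<xi> \<in> ?U"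
    then obtain y where y: "y \<in> S" "real k * (\<xi> \<bullet> y) \<le> real ?n * v"
      using S(4) by blast
    then obtain i where i: "i \<in> {1..k}" "f i = y"
      using f by blast
    have "q * (\<xi> \<bullet> y) \<le> v"
      using y(2) assms(9) by (simp add: mult.assoc mult.left_commute)
    also have "\<dots> \<le> q * (1 + a ?n) * v"
      using mult_right_mono[OF q \<open>v \<ge> 0\<close>] by simp
    finally have "q * (\<xi> \<bullet> y) \<le> q * ((1 + a ?n) * v)"
      by (simp only: mult.assoc)
    then have "\<xi> \<bullet> y \<le> (1 + a ?n) * v"
      using assms(8) by simp
    \<comment> \<open>Nonnegative first-stage cost lets the factor \<open>1 + a\<close>, obtained
      for \<open>v\<close>, apply to the total \<open>?d \<bullet> x + v\<close>, which is the
      optimum.\<close>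
    moreover have "?d \<bullet> x \<le> (1 + a ?n) * (?d \<bullet> x)"
      using a dx by (simp add: algebra_simps)
    moreover have "adapt_recourse_value I k ?s \<xi> \<le> ?d \<bullet> x + \<xi> \<bullet> y"
      unfolding adapt_recourse_value_def prod.case
      by (intro Min_le) (use i in \<open>auto intro!: rev_image_eqI\<close>)
    ultimately show "adapt_recourse_value I k ?s \<xi> \<le> (1 + a ?n) * opt_2RO I"
      by (simp add: v_def algebra_simps)
  qed
  finally show ?thesis .
qed

end
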